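(* Let $m\ge 5$ be an integer and let positive numbers $a,b$ satisfy $2a^2+b=1$. Then the map $$f:\mathbb{D}\to\mathcal{E}:=\{z\in\mathbb{C}^3:|z_1|^2+|z_2|^2+|z_3|<1\},\qquad f(\lambda):=(a\lambda,a\lambda^{m-2},b\lambda^{m-1}),$$ is an $m$-geodesic of $\mathcal{E}$ such that $\varphi(\lambda):=f(\lambda)/\lambda$ is not an $(m-1)$-geodesic of $\mathcal{E}$.
   Context: $\mathbb{D}$ is the open unit disc in $\mathbb{C}$. A finite Blaschke product of degree $k\in\{0,1,2,\ldots\}$ is a function $\zeta\prod_{j=1}^k m_{\alpha_j}$ with $|\zeta|=1$, $\alpha_j\in\mathbb{D}$, $m_\alpha(\lambda)=\frac{\lambda-\alpha}{1-\overline{\alpha}\lambda}$. For an integer $l\ge 2$, a holomorphic mapping $f:\mathbb{D}\to D$ into a domain $D\subset\mathbb{C}^n$ is an $l$-geodesic if there is a holomorphic $F:D\to\mathbb{D}$ such that $F\circ f$ is a non-constant Blaschke product of degree at most $l-1$. *)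

theory Defs
  imports "HOL-Complex_Analysis.Complex_Analysis"
begin

abbreviation unit_disc :: "complex set"
  where "unit_disc \<equiv> ball 0 1"

text \<open>\<^term>\<open>Moebius_function 0 \<alpha>\<close> is the map sending \<open>\<lambda>\<close> to \<open>(\<lambda> - \<alpha>) / (1 - cnj \<alpha> * \<lambda>)\<close>.\<close>

definition finite_Blaschke_product :: "nat \<Rightarrow> (complex \<Rightarrow> complex) \<Rightarrow> bool"
  where "finite_Blaschke_product k B \<longleftrightarrow>
    (\<exists>\<zeta> \<alpha>. norm \<zeta> = 1 \<and> (\<forall>j<k. \<alpha> j \<in> unit_disc) \<and>
      (\<forall>z\<in>unit_disc. B z = \<zeta> * (\<Prod>j<k. Moebius_function 0 (\<alpha> j) z)))"

text \<open>Holomorphy in several variables: Frechet differentiability with a complex-linear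
  derivative. It is meant for open \<open>D\<close> only.\<close>

definition holomorphic_several_on :: "(complex ^ 'n \<Rightarrow> complex) \<Rightarrow> (complex ^ 'n) set \<Rightarrow> bool"
  where "holomorphic_several_on F D \<longleftrightarrow>
    (\<forall>z\<in>D. \<exists>F'. (F has_derivative F') (at z) \<and> Vector_Spaces.linear (*s) (*) F')"

definition holomorphic_disc_map :: "(complex \<Rightarrow> complex ^ 'n) \<Rightarrow> (complex ^ 'n) set \<Rightarrow> bool"
  where "holomorphic_disc_map f D \<longleftrightarrow>
    (\<forall>i. (\<lambda>z. f z $ i) holomorphic_on unit_disc) \<and> f ` unit_disc \<subseteq> D"

text \<open>For \<open>l < 2\<close> no map is an \<open>l\<close>-geodesic, since a Blaschke product of degree 0 is constant.\<close>

definition geodesic :: "nat \<Rightarrow> (complex \<Rightarrow> complex ^ 'n) \<Rightarrow> (complex ^ 'n) set \<Rightarrow> bool"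
  where "geodesic l f D \<longleftrightarrow>
    open D \<and> connected D \<and> holomorphic_disc_map f D \<and>
    (\<exists>F. holomorphic_several_on F D \<and> F ` D \<subseteq> unit_disc \<and>
      \<not> (F \<circ> f) constant_on unit_disc \<and>
      (\<exists>k\<le>l - 1. finite_Blaschke_product k (F \<circ> f)))"

definition ellipsoid :: "(complex ^ 3) set"
  where "ellipsoid = {z. (norm (z $ 1))\<^sup>2 + (norm (z $ 2))\<^sup>2 + norm (z $ 3) < 1}"

text \<open>The map \<open>f(\<lambda>)/\<lambda>\<close>, with its removable singularity at 0 filled in componentwise.\<close>

definition divide_by_id :: "(complex \<Rightarrow> complex ^ 'n) \<Rightarrow> complex \<Rightarrow> complex ^ 'n"
  where "divide_by_id f z = (\<chi> i. remove_sings (\<lambda>w. f w $ i / w) z)"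

end

(* Put p = m - 3, so that phi(z) = (a, a z^p, b z^(p+1)); z |-> 2 z1 z2 + z3 is a left inverse
   witnessing that f is an m-geodesic.  Suppose F maps the ellipsoid into the disc and
   B = F o phi is a Blaschke product of degree at most p + 1.  The field
   v(z) = (0, 1, -2 a z) along phi is complex tangent to the boundary on the unit circle, so
   phi(z) + t v(z) stays in the ellipsoid for |t| < delta sqrt(1 - |z|), whereas
   1 - |B(z)|^2 = O(1 - |z|).  Schwarz-Pick on these discs and the maximum principle in z force
   the derivative of F at phi(z) to annihilate v(z) for every z.  Hence B'(z) is a constant times
   z^(p-1) times the second partial derivative of F at phi(z), and that derivative vanishes at
   phi(0) since v(0) is the second unit vector.  As phi(z) - phi(0) = O(z^p), it is O(z^p) along
   phi, so B' = O(z^(2p-1)) = O(z^(p+1)); with p >= 2, B - B(0) vanishes at 0 to an order exceeding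
   the degree of B, and B is constant. *)

theory Submission
  imports Defs
begin

unbundle no fps_syntax

section \<open>Complex differentiation along curves in several variables\<close>

lemma norm_vector_scalar_mult:
  fixes w :: "complex ^ 'n"
  shows "norm (s *s w) = norm s * norm w"
  by (simp add: norm_vec_def norm_mult L2_set_right_distrib)

text \<open>The real chain rule gives the derivative \<open>h \<mapsto> F' (h *s g')\<close>;
  complex linearity of \<open>F'\<close> pulls out the scalar \<open>h\<close>, which makes it a
  complex derivative.\<close>

lemma has_field_derivative_compose_curve:
  fixes g :: "complex \<Rightarrow> complex ^ 'n"
  assumes F: "(F has_derivative F') (at (g s))" and lin: "Vector_Spaces.linear (*s) (*) F'"
    and g: "\<And>i. ((\<lambda>s. g s $ i) has_field_derivative g' $ i) (at s)"
  shows "((\<lambda>s. F (g s)) has_field_derivative F' g') (at s)"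
proof -
  have "(g has_derivative (\<lambda>h. h *s g')) (at s)"
    unfolding has_derivative_componentwise_within[of g]
  proof
    fix e :: "complex ^ 'n" assume "e \<in> Basis"
    then obtain i u where e: "e = axis i u" "u \<in> Basis"
      by (auto simp: Basis_vec_def)
    have "((\<lambda>s. g s $ i) has_derivative (\<lambda>h. h * g' $ i)) (at s)"
      using g[of i] unfolding has_field_derivative_def
      by (simp add: mult.commute[of _ "g' $ i"])
    then show "((\<lambda>s. g s \<bullet> e) has_derivative (\<lambda>h. (h *s g') \<bullet> e)) (at s)"
      by (simp add: e inner_axis has_derivative_inner_left)
  qed
  from has_derivative_compose[OF this F]
  have "((\<lambda>s. F (g s)) has_derivative (\<lambda>h. F' (h *s g'))) (at s)" .
  moreover have "F' (h *s g') = F' g' * h" for h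
    using lin by (simp add: linear_iff_module_hom module_hom.scale mult.commute)
  ultimately show ?thesis
    by (simp add: has_field_derivative_def)
qed

lemma holomorphic_on_compose_curve:
  fixes g :: "complex \<Rightarrow> complex ^ 'n"
  assumes F: "holomorphic_several_on F D" and "open S"
    and g: "\<And>i. (\<lambda>s. g s $ i) holomorphic_on S" and D: "g ` S \<subseteq> D"
  shows "(\<lambda>s. F (g s)) holomorphic_on S"
proof -
  have "(\<lambda>s. F (g s)) field_differentiable at s" if s: "s \<in> S" for s
  proof -
    obtain F' where "(F has_derivative F') (at (g s))" "Vector_Spaces.linear (*s) (*) F'"
      using F D s unfolding holomorphic_several_on_def by blast
    moreover have "((\<lambda>s. g s $ i) has_field_derivative (\<chi> i. deriv (\<lambda>s. g s $ i) s) $ i) (at s)" for i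
      using holomorphic_derivI[OF g \<open>open S\<close> s] by simp
    ultimately show ?thesis
      using has_field_derivative_compose_curve field_differentiable_def by blast
  qed
  then show ?thesis
    using \<open>open S\<close> by (simp add: holomorphic_on_open field_differentiable_def)
qed

section \<open>The Schwarz-Pick estimate and finite Blaschke products\<close>

text \<open>After rescaling to the unit disc and moving \<open>k 0\<close> to 0 by a Moebius map,
  Schwarz's lemma applies. Solving for the increment leaves it on both sides;
  \<open>norm t \<le> R / 2\<close> lets the right-hand copy be absorbed at the cost of the factor
  2.\<close>

lemma Schwarz_Pick_increment:
  assumes holk: "k holomorphic_on ball 0 R" and k: "k ` ball 0 R \<subseteq> unit_disc"
    and R: "0 < R" and t: "norm t \<le> R / 2"
  shows "norm (k t - k 0) \<le> 2 * (norm t / R) * (1 - (norm (k 0))\<^sup>2)"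
proof -
  define c where "c = k 0"
  define q where "q = (\<lambda>s. Moebius_function 0 c (k (of_real R * s)))"
  have c: "norm c < 1"
    using k R by (force simp: c_def)
  have sub: "(\<lambda>s. of_real R * s) ` unit_disc \<subseteq> ball 0 R"
    using R by (auto simp: norm_mult)
  have "(\<lambda>s. k (of_real R * s)) holomorphic_on unit_disc"
    using holomorphic_on_compose_gen[OF _ holk sub] by (auto simp: o_def intro!: holomorphic_intros)
  from holomorphic_on_compose_gen[OF this Moebius_function_holomorphic[OF c]]
  have "q holomorphic_on unit_disc"
    using k sub by (force simp: q_def o_def)
  moreover have "q 0 = 0"
    by (simp add: q_def c_def Moebius_function_eq_zero)
  moreover have "norm (q z) < 1" if "norm z < 1" for z
    unfolding q_def using that k sub c by (intro Moebius_function_norm_lt_1) force+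
  ultimately have q: "norm (q z) \<le> norm z" if "norm z < 1" for z
    using Schwarz_Lemma(1) that by blast
  define s where "s = t / of_real R"
  have s: "norm s = norm t / R" "norm s \<le> 1/2" "of_real R * s = t"
    using R t by (auto simp: s_def norm_divide field_simps)
  define d where "d = norm (k t - c)"
  have "norm (k t) < 1"
    using k t R by (force simp: subset_iff)
  then have "norm (cnj c * k t) < 1"
    using c by (simp add: norm_mult) (metis mult_le_one norm_ge_zero less_eq_real_def mult_less_cancel_left2 order.strict_trans2 mult.commute mult_left_le_one_le)
  then have ne: "1 - cnj c * k t \<noteq> 0"
    by auto
  have "norm (q s) \<le> norm s"
    by (rule q) (use s in linarith)
  moreover have "k t - c = q s * (1 - cnj c * k t)"
    using ne by (simp add: q_def s Moebius_function_simple)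
  ultimately have "d \<le> norm s * norm (1 - cnj c * k t)"
    unfolding d_def by (simp add: norm_mult mult_right_mono)
  \<comment> \<open>Expanding the denominator around \<open>c\<close> produces the factor
    \<open>1 - |c|^2\<close>; the remainder is a multiple of the increment itself.\<close>
  also have "1 - cnj c * k t = of_real (1 - (norm c)\<^sup>2) - cnj c * (k t - c)"
    using complex_norm_square[of c] by (simp add: algebra_simps)
  also have "norm \<dots> \<le> (1 - (norm c)\<^sup>2) + norm c * d"
    using c unfolding d_def
    by (intro norm_triangle_ineq4[THEN order_trans])
       (simp only: norm_mult norm_of_real complex_mod_cnj, simp add: power2_eq_square mult_le_one)
  also have "\<dots> \<le> (1 - (norm c)\<^sup>2) + d"
    using c by (simp add: d_def mult_left_le_one_le)
  finally have "d \<le> norm s * (1 - (norm c)\<^sup>2) + norm s * d"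
    by (simp add: mult_left_mono distrib_left)
  moreover have "norm s * d \<le> 1/2 * d"
    using s by (intro mult_right_mono) (auto simp: d_def)
  ultimately have "d \<le> 2 * (norm s * (1 - (norm c)\<^sup>2))"
    by linarith
  then show ?thesis
    by (simp add: s(1) d_def c_def)
qed

text \<open>For a single factor, \<open>1 - |m_w(z)|^2\<close> equals
  \<open>(1 - |w|^2)(1 - |z|^2) / |1 - cnj w z|^2\<close>, whose denominator is at least
  \<open>(1 - |w|)^2\<close>. Defects are subadditive under products:
  \<open>1 - X Y \<le> (1 - X) + (1 - Y)\<close> for \<open>X, Y \<le> 1\<close>, so the constants
  of the factors add up.\<close>

lemma finite_Blaschke_product_boundary_bound:
  assumes "finite_Blaschke_product k B"
  obtains C where "C > 0" "\<And>z. z \<in> unit_disc \<Longrightarrow> 1 - (norm (B z))\<^sup>2 \<le> C * (1 - norm z)"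
proof -
  from assms obtain \<zeta> \<alpha> where \<zeta>: "norm \<zeta> = 1" and \<alpha>: "\<And>j. j < k \<Longrightarrow> norm (\<alpha> j) < 1"
    and B: "\<And>z. z \<in> unit_disc \<Longrightarrow> B z = \<zeta> * (\<Prod>j<k. Moebius_function 0 (\<alpha> j) z)"
    unfolding finite_Blaschke_product_def by (metis mem_ball_0)
  have Moebius: "1 - (norm (Moebius_function 0 w z))\<^sup>2 \<le> 2 / (1 - norm w)\<^sup>2 * (1 - norm z)"
    if w: "norm w < 1" and z: "norm z < 1" for w z
  proof -
    have le: "1 - norm w \<le> norm (1 - cnj w * z)"
    proof -
      have "1 - norm (cnj w * z) \<le> norm (1 - cnj w * z)"
        by (metis norm_one norm_triangle_ineq2)
      moreover have "norm (cnj w * z) \<le> norm w"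
        using z by (simp add: norm_mult mult_right_le_one_le)
      ultimately show ?thesis by linarith
    qed
    then have pos: "norm (1 - cnj w * z) > 0"
      using w by linarith
    have "(norm (1 - cnj w * z))\<^sup>2 - (norm (z - w))\<^sup>2 = (1 - (norm w)\<^sup>2) * (1 - (norm z)\<^sup>2)"
      unfolding cmod_power2 by (simp add: algebra_simps power2_eq_square)
    then have "1 - (norm (Moebius_function 0 w z))\<^sup>2
        = (1 - (norm w)\<^sup>2) * (1 - (norm z)\<^sup>2) / (norm (1 - cnj w * z))\<^sup>2"
      using pos by (simp add: Moebius_function_simple norm_divide power_divide field_simps)
    also have "\<dots> \<le> 1 * (2 * (1 - norm z)) / (1 - norm w)\<^sup>2"
    proof (intro frac_le mult_mono power_mono le)
      have "1 - (norm z)\<^sup>2 = (1 + norm z) * (1 - norm z)"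
        by (simp add: power2_eq_square algebra_simps)
      also have "\<dots> \<le> 2 * (1 - norm z)"
        using z by (intro mult_right_mono) auto
      finally show "1 - (norm z)\<^sup>2 \<le> 2 * (1 - norm z)" .
    qed (use w z in \<open>auto simp: power_le_one\<close>)
    finally show ?thesis by simp
  qed
  have "\<exists>C>0. \<forall>z\<in>unit_disc. 1 - (norm (\<zeta> * (\<Prod>j<n. Moebius_function 0 (\<alpha> j) z)))\<^sup>2 \<le> C * (1 - norm z)"
    if "n \<le> k" for n
    using that
  proof (induction n)
    case 0
    show ?case
      by (rule exI[of _ 1]) (simp add: \<zeta>)
  next
    case (Suc n)
    then obtain C where C: "C > 0"
      "\<And>z. z \<in> unit_disc \<Longrightarrow> 1 - (norm (\<zeta> * (\<Prod>j<n. Moebius_function 0 (\<alpha> j) z)))\<^sup>2 \<le> C * (1 - norm z)"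
      by auto
    have w: "norm (\<alpha> n) < 1"
      using Suc.prems \<alpha> by simp
    define C' where "C' = 2 / (1 - norm (\<alpha> n))\<^sup>2"
    have "C' > 0"
      using w by (simp add: C'_def)
    moreover have "1 - (norm (\<zeta> * (\<Prod>j<Suc n. Moebius_function 0 (\<alpha> j) z)))\<^sup>2 \<le> (C + C') * (1 - norm z)"
      if z: "z \<in> unit_disc" for z
    proof -
      define X where "X = (norm (\<zeta> * (\<Prod>j<n. Moebius_function 0 (\<alpha> j) z)))\<^sup>2"
      define Y where "Y = (norm (Moebius_function 0 (\<alpha> n) z))\<^sup>2"
      have "norm (\<Prod>j<n. Moebius_function 0 (\<alpha> j) z) \<le> 1"
        using Suc.prems z \<alpha> Moebius_function_norm_lt_1
        unfolding prod_norm[symmetric] by (intro prod_le_1) (auto intro: less_imp_le)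
      then have "X \<le> 1"
        by (simp add: X_def norm_mult \<zeta> power_le_one)
      have "Y \<le> 1"
        using Moebius_function_norm_lt_1[OF w, of z] z by (simp add: Y_def power_le_one less_imp_le)
      have "X + Y \<le> 1 + X * Y"
        using mult_nonneg_nonneg[of "1 - X" "1 - Y"] \<open>X \<le> 1\<close> \<open>Y \<le> 1\<close> by (simp add: algebra_simps)
      moreover have "1 - X \<le> C * (1 - norm z)" "1 - Y \<le> C' * (1 - norm z)"
        using C(2)[OF z] Moebius[OF w, of z] z by (auto simp: X_def Y_def C'_def)
      moreover have "(norm (\<zeta> * (\<Prod>j<Suc n. Moebius_function 0 (\<alpha> j) z)))\<^sup>2 = X * Y"
        by (simp add: X_def Y_def norm_mult power_mult_distrib)
      ultimately show ?thesis
        by (simp add: distrib_right)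
    qed
    ultimately show ?case
      using C(1) by (intro exI[of _ "C + C'"]) auto
  qed
  from this[of k] show ?thesis
    using that B by auto
qed

text \<open>Clearing denominators allows vanishing orders to be compared with polynomial degrees.
  Each \<open>\<alpha> j = 0\<close> lowers the degree of \<open>Q\<close>, hence an upper bound
  only.\<close>

lemma finite_Blaschke_product_rational:
  assumes "finite_Blaschke_product k B"
  obtains P Q where "degree P \<le> k" "degree Q \<le> k"
    "\<And>z. z \<in> unit_disc \<Longrightarrow> poly Q z \<noteq> 0" "\<And>z. z \<in> unit_disc \<Longrightarrow> B z * poly Q z = poly P z"
proof -
  from assms obtain \<zeta> \<alpha> where \<alpha>: "\<And>j. j < k \<Longrightarrow> norm (\<alpha> j) < 1"
    and B: "\<And>z. z \<in> unit_disc \<Longrightarrow> B z = \<zeta> * (\<Prod>j<k. Moebius_function 0 (\<alpha> j) z)"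
    unfolding finite_Blaschke_product_def by (metis mem_ball_0)
  define P where "P = smult \<zeta> (\<Prod>j<k. [:- \<alpha> j, 1:])"
  define Q where "Q = (\<Prod>j<k. [:1, - cnj (\<alpha> j):])"
  have ne: "1 - cnj (\<alpha> j) * z \<noteq> 0" if "j < k" "z \<in> unit_disc" for j z
  proof -
    have "norm (cnj (\<alpha> j) * z) < 1 * 1"
      unfolding norm_mult using that \<alpha>[of j] by (intro mult_strict_mono') auto
    then show ?thesis by auto
  qed
  have deg: "degree (\<Prod>j<k. [:f j, g j:]) \<le> k" for f g :: "nat \<Rightarrow> complex"
  proof -
    have "degree (\<Prod>j<k. [:f j, g j:]) \<le> (\<Sum>j<k. degree [:f j, g j:])"
      by (rule order_trans[OF degree_prod_sum_le]) (simp_all add: o_def)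
    also have "\<dots> \<le> (\<Sum>j<k. 1)"
      by (intro sum_mono) simp
    finally show ?thesis by simp
  qed
  show ?thesis
  proof
    show "degree P \<le> k"
      unfolding P_def by (rule order_trans[OF degree_smult_le deg])
    show "degree Q \<le> k"
      unfolding Q_def by (rule deg)
    show "poly Q z \<noteq> 0" if "z \<in> unit_disc" for z
      using ne[OF _ that] by (auto simp: Q_def poly_prod mult.commute)
    show "B z * poly Q z = poly P z" if "z \<in> unit_disc" for z
      using ne[OF _ that] unfolding B[OF that] P_def Q_def
      by (simp add: poly_prod mult.assoc mult.commute[of z] Moebius_function_simple flip: prod.distrib)
  qed
qed

text \<open>Writing \<open>B = P / Q\<close>, the polynomial \<open>P - B(0) Q\<close> has degree at
  most \<open>k\<close> but would vanish at 0 to order at least \<open>k + 1\<close>, so it is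
  zero.\<close>

lemma finite_Blaschke_product_constant:
  assumes B: "finite_Blaschke_product k B" and "\<epsilon> > 0"
    and le: "\<And>z. norm z < \<epsilon> \<Longrightarrow> norm (B z - B 0) \<le> C * norm z ^ Suc k"
  shows "B constant_on unit_disc"
proof -
  obtain P Q where deg: "degree P \<le> k" "degree Q \<le> k"
    and Q: "\<And>z. z \<in> unit_disc \<Longrightarrow> poly Q z \<noteq> 0"
    and BQ: "\<And>z. z \<in> unit_disc \<Longrightarrow> B z * poly Q z = poly P z"
    using finite_Blaschke_product_rational[OF B] by metis
  define R where "R = P - smult (B 0) Q"
  have R: "poly R z = (B z - B 0) * poly Q z" if "z \<in> unit_disc" for z
    using BQ[OF that] by (simp add: R_def algebra_simps)
  have "R = 0"
  proof (rule ccontr)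
    assume "R \<noteq> 0"
    \<comment> \<open>Split off the exact power \<open>z^n\<close> dividing \<open>R\<close>. As
      \<open>n \<le> k\<close>, cancelling it from the bound leaves a positive power of
      \<open>norm z\<close>, so \<open>S\<close> vanishes at 0, against the choice of
      \<open>n\<close>.\<close>
    then obtain S where S: "R = [:- 0, 1:] ^ order 0 R * S" "\<not> [:- 0, 1:] dvd S"
      using order_decomp by blast
    define n where "n = order 0 R"
    have "n \<le> k"
      using order_degree[OF \<open>R \<noteq> 0\<close>, of 0] deg degree_smult_le[of "B 0" Q]
      unfolding n_def R_def by (meson degree_diff_le order_trans)
    have "\<forall>\<^sub>F z in at 0. norm (poly S z) \<le> \<bar>C\<bar> * norm z ^ Suc (k - n) * norm (poly Q z)"
      unfolding eventually_at
    proof (intro exI[of _ "min \<epsilon> 1"] conjI ballI impI)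
      fix z :: complex assume "z \<noteq> 0 \<and> dist z 0 < min \<epsilon> 1"
      then have z: "z \<noteq> 0" "norm z < \<epsilon>" "norm z < 1" by auto
      have "norm z ^ n * norm (poly S z) = norm (poly R z)"
        by (subst S(1)) (simp add: n_def norm_mult norm_power)
      also have "\<dots> \<le> \<bar>C\<bar> * norm z ^ Suc k * norm (poly Q z)"
      proof -
        have "norm (B z - B 0) \<le> \<bar>C\<bar> * norm z ^ Suc k"
          by (rule order_trans[OF le[OF z(2)] mult_right_mono]) auto
        then show ?thesis
          using R[of z] z(3) by (simp add: norm_mult mult_right_mono)
      qed
      also have "norm z ^ Suc k = norm z ^ n * norm z ^ Suc (k - n)"
        using power_add[of "norm z" n "Suc (k - n)"] \<open>n \<le> k\<close> by simp
      finally have "norm z ^ n * norm (poly S z) \<le> norm z ^ n * (\<bar>C\<bar> * norm z ^ Suc (k - n) * norm (poly Q z))"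
        by (simp add: mult_ac)
      then show "norm (poly S z) \<le> \<bar>C\<bar> * norm z ^ Suc (k - n) * norm (poly Q z)"
        using z(1) by (simp add: mult_le_cancel_left)
    qed (use \<open>\<epsilon> > 0\<close> in auto)
    moreover have "((\<lambda>z. norm (poly S z)) \<longlongrightarrow> norm (poly S 0)) (at 0)"
      by (intro tendsto_intros)
    moreover have "((\<lambda>z. \<bar>C\<bar> * norm z ^ Suc (k - n) * norm (poly Q z)) \<longlongrightarrow>
        \<bar>C\<bar> * norm (0::complex) ^ Suc (k - n) * norm (poly Q 0)) (at 0)"
      by (intro tendsto_intros)
    ultimately have "norm (poly S 0) \<le> \<bar>C\<bar> * norm (0::complex) ^ Suc (k - n) * norm (poly Q 0)"
      by (intro tendsto_le[of "at (0::complex)"]) auto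
    then have "poly S 0 = 0" by simp
    then show False
      using S(2) unfolding poly_eq_0_iff_dvd by contradiction
  qed
  then have "B z = B 0" if "z \<in> unit_disc" for z
    using R[OF that] Q[OF that] by simp
  then show ?thesis
    unfolding constant_on_def by blast
qed

section \<open>Local Lipschitz bounds for bounded holomorphic functions and their
  derivatives\<close>

text \<open>Schwarz-Pick is applied to the restriction of \<open>F\<close> to the complex line
  through \<open>x\<close> and \<open>y\<close>, with parameter 0 at \<open>y\<close> and 1 at
  \<open>x\<close>.\<close>

lemma holomorphic_several_on_Lipschitz:
  fixes F :: "complex ^ 'n \<Rightarrow> complex"
  assumes hol: "holomorphic_several_on F D" and F: "F ` D \<subseteq> unit_disc"
    and "\<rho> > 0" and D: "ball x0 (5 * \<rho>) \<subseteq> D" and x: "x \<in> ball x0 \<rho>" and y: "y \<in> ball x0 \<rho>"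
  shows "norm (F x - F y) \<le> norm (x - y) / (2 * \<rho>)"
proof (cases "x = y")
  case False
  define n where "n = norm (x - y)"
  have n: "n > 0" "n < 2 * \<rho>"
    using False x y dist_triangle_less_add[of x x0 \<rho> y \<rho>]
    by (auto simp: n_def dist_norm norm_minus_commute)
  \<comment> \<open>For \<open>norm s < R\<close> the displacement from \<open>y\<close> is below
    \<open>4 * \<rho>\<close>, which stays in the large ball; \<open>n < 2 * \<rho>\<close> gives
    \<open>R / 2 > 1\<close>, so the parameter 1 is admissible.\<close>
  define R where "R = 4 * \<rho> / n"
  define k where "k = (\<lambda>s. F (y + s *s (x - y)))"
  have sub: "(\<lambda>s. y + s *s (x - y)) ` ball 0 R \<subseteq> D"
  proof (intro image_subsetI subsetD[OF D])
    fix s :: complex assume "s \<in> ball 0 R"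
    then have "norm s < R" by simp
    have "norm (s *s (x - y)) = norm s * n"
      by (simp only: norm_vector_scalar_mult n_def)
    also have "\<dots> < 4 * \<rho>"
      using \<open>norm s < R\<close> n by (simp add: R_def field_simps)
    finally have "norm (s *s (x - y)) < 4 * \<rho>" .
    moreover have "dist x0 (y + s *s (x - y)) \<le> dist x0 y + norm (s *s (x - y))"
      by (metis dist_triangle dist_commute dist_norm add_diff_cancel_left')
    ultimately show "y + s *s (x - y) \<in> ball x0 (5 * \<rho>)"
      using y by simp
  qed
  have "k holomorphic_on ball 0 R"
    unfolding k_def by (rule holomorphic_on_compose_curve[OF hol _ _ sub]) (auto intro!: holomorphic_intros)
  moreover have "k ` ball 0 R \<subseteq> unit_disc"
    unfolding k_def using sub F by blast
  moreover have "R > 0" "norm (1::complex) \<le> R / 2"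
    using n by (auto simp: R_def field_simps)
  ultimately have "norm (k 1 - k 0) \<le> 2 * (norm (1::complex) / R) * (1 - (norm (k 0))\<^sup>2)"
    by (rule Schwarz_Pick_increment)
  also have "\<dots> \<le> 2 * (norm (1::complex) / R) * 1"
    using \<open>R > 0\<close> by (intro mult_left_mono) auto
  also have "\<dots> = n / (2 * \<rho>)"
    by (simp add: R_def)
  finally show ?thesis
    by (simp add: k_def n_def)
qed simp

text \<open>Second derivatives are avoided: the slices of \<open>F\<close> in direction
  \<open>w\<close> through \<open>x\<close> and \<open>x0\<close> differ by
  \<open>O(norm (x - x0))\<close> on a fixed circle, and Cauchy's inequality passes this bound to
  the difference of their derivatives at 0.\<close>

lemma holomorphic_several_on_derivative_Lipschitz:
  fixes F :: "complex ^ 'n \<Rightarrow> complex"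
  assumes hol: "holomorphic_several_on F D" and F: "F ` D \<subseteq> unit_disc"
    and DF: "\<And>x. x \<in> D \<Longrightarrow> (F has_derivative DF x) (at x)"
    and lin: "\<And>x. x \<in> D \<Longrightarrow> Vector_Spaces.linear (*s) (*) (DF x)"
    and "open D" "x0 \<in> D"
  obtains C \<epsilon> where "\<epsilon> > 0" "C \<ge> 0"
    "\<And>x. x \<in> ball x0 \<epsilon> \<Longrightarrow> norm (DF x w - DF x0 w) \<le> C * norm (x - x0)"
proof -
  obtain e where "e > 0" and e: "ball x0 e \<subseteq> D"
    using \<open>open D\<close> \<open>x0 \<in> D\<close> open_contains_ball by blast
  define \<rho> where "\<rho> = e / 5"
  have \<rho>: "\<rho> > 0" "ball x0 (5 * \<rho>) \<subseteq> D"
    using \<open>e > 0\<close> e by (auto simp: \<rho>_def)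
  \<comment> \<open>Makes \<open>s *s w\<close> no longer than \<open>\<rho> / 2\<close> whenever
    \<open>norm s \<le> \<sigma>\<close>; the summand 1 covers \<open>w = 0\<close>.\<close>
  define \<sigma> where "\<sigma> = \<rho> / (2 * (norm w + 1))"
  have "norm w + 1 > 0"
    using norm_ge_zero[of w] by linarith
  then have "\<sigma> > 0"
    using \<rho> by (simp add: \<sigma>_def)
  have near: "x + s *s w \<in> ball x0 \<rho>" if x: "x \<in> ball x0 (\<rho> / 2)" and s: "norm s \<le> \<sigma>" for x s
  proof -
    have "norm (s *s w) \<le> \<sigma> * norm w"
      using s by (simp add: norm_vector_scalar_mult mult_right_mono)
    also have "\<dots> \<le> \<rho> / 2"
      using \<rho> \<open>norm w + 1 > 0\<close> by (simp add: \<sigma>_def field_simps)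
    finally have "norm (s *s w) \<le> \<rho> / 2" .
    moreover have "dist x0 (x + s *s w) \<le> dist x0 x + norm (s *s w)"
      by (metis dist_triangle dist_commute dist_norm add_diff_cancel_left')
    ultimately show ?thesis
      using x by simp
  qed
  have inD: "ball x0 \<rho> \<subseteq> D"
    using \<rho> by (auto intro!: subsetD[OF \<rho>(2)])
  have slice: "((\<lambda>s. F (x + s *s w)) has_field_derivative DF (x + s *s w) w) (at s)"
    if "x \<in> ball x0 (\<rho> / 2)" "norm s \<le> \<sigma>" for x s
  proof (rule has_field_derivative_compose_curve[OF DF lin])
    show "x + s *s w \<in> D"
      using near[OF that] inD by (rule rev_subsetD)
    then show "x + s *s w \<in> D" .
    show "((\<lambda>s. (x + s *s w) $ i) has_field_derivative w $ i) (at s)" for i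
      unfolding vector_add_component vector_smult_component
      by (auto intro!: derivative_eq_intros)
  qed
  show ?thesis
  proof
    show "\<rho> / 2 > 0" "1 / (2 * \<rho> * \<sigma>) \<ge> 0"
      using \<rho> \<open>\<sigma> > 0\<close> by auto
    fix x assume x: "x \<in> ball x0 (\<rho> / 2)"
    define h where "h = (\<lambda>s. F (x + s *s w) - F (x0 + s *s w))"
    have x0: "x0 \<in> ball x0 (\<rho> / 2)"
      using \<rho> by simp
    have h: "(h has_field_derivative DF (x + s *s w) w - DF (x0 + s *s w) w) (at s)" if "norm s \<le> \<sigma>" for s
      unfolding h_def by (intro DERIV_diff slice x x0 that)
    have "norm ((deriv ^^ 1) h 0) \<le> fact 1 * (norm (x - x0) / (2 * \<rho>)) / \<sigma> ^ 1"
    proof (rule Cauchy_inequality[OF _ _ \<open>\<sigma> > 0\<close>])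
      show "h holomorphic_on ball 0 \<sigma>"
        by (rule holomorphic_onI, rule field_differentiable_at_within)
           (auto simp: field_differentiable_def intro!: exI h)
      show "continuous_on (cball 0 \<sigma>) h"
        by (intro continuous_at_imp_continuous_on ballI DERIV_isCont[OF h]) auto
      show "norm (h s) \<le> norm (x - x0) / (2 * \<rho>)" if "norm (0 - s) = \<sigma>" for s
        using holomorphic_several_on_Lipschitz[OF hol F \<rho> near[OF x, of s] near[OF x0, of s]] that
        by (simp add: h_def)
    qed
    moreover have "deriv h 0 = DF x w - DF x0 w"
      using h[of 0] \<open>\<sigma> > 0\<close> by (intro DERIV_imp_deriv) simp
    ultimately show "norm (DF x w - DF x0 w) \<le> 1 / (2 * \<rho> * \<sigma>) * norm (x - x0)"
      by simp
  qed
qed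

lemma has_field_derivative_0_if_quadratic_bound:
  fixes h :: "complex \<Rightarrow> complex"
  assumes h: "(h has_field_derivative d) (at 0)" and "\<eta> > 0"
    and le: "\<And>t. t \<noteq> 0 \<Longrightarrow> norm t < \<eta> \<Longrightarrow> norm (h t - h 0) \<le> C * (norm t)\<^sup>2"
  shows "d = 0"
proof -
  have "((\<lambda>t. (h t - h 0) / t) \<longlongrightarrow> d) (at 0)"
    using h by (simp add: has_field_derivative_iff)
  moreover have "((\<lambda>t. (h t - h 0) / t) \<longlongrightarrow> 0) (at 0)"
  proof (rule Lim_null_comparison)
    show "\<forall>\<^sub>F t in at 0. norm ((h t - h 0) / t) \<le> C * norm t"
      unfolding eventually_at
    proof (intro exI[of _ \<eta>] conjI ballI impI)
      fix t :: complex assume "t \<noteq> 0 \<and> dist t 0 < \<eta>"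
      then show "norm ((h t - h 0) / t) \<le> C * norm t"
        using le[of t] by (simp add: norm_divide divide_le_eq power2_eq_square)
    qed (use \<open>\<eta> > 0\<close> in auto)
    show "((\<lambda>t. C * norm t) \<longlongrightarrow> 0) (at 0)"
      by (auto intro!: tendsto_eq_intros)
  qed
  ultimately show ?thesis
    by (rule tendsto_unique[rotated]) simp
qed

section \<open>Geometry of the ellipsoid and its tangent discs\<close>

lemma open_ellipsoid: "open ellipsoid"
  unfolding ellipsoid_def by (intro open_Collect_less continuous_intros)

lemma connected_ellipsoid: "connected ellipsoid"
proof (rule starlike_imp_connected, unfold starlike_def, intro bexI ballI subsetI)
  fix x y :: "complex ^ 3" assume x: "x \<in> ellipsoid" and "y \<in> closed_segment 0 x"
  then obtain u where u: "0 \<le> u" "u \<le> 1" "y = u *\<^sub>R x"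
    by (auto simp: in_segment)
  have "(norm (y $ i))\<^sup>2 \<le> (norm (x $ i))\<^sup>2" "norm (y $ i) \<le> norm (x $ i)" for i
    using u by (auto simp: mult_left_le_one_le intro!: power_mono)
  from this(1)[of 1] this(1)[of 2] this(2)[of 3] x show "y \<in> ellipsoid"
    unfolding ellipsoid_def mem_Collect_eq by linarith
qed (simp add: ellipsoid_def)

text \<open>At \<open>t = 0\<close> the defining sum is at most
  \<open>2 a^2 + b |z| = 1 - b (1 - |z|)\<close>, a slack of \<open>b (1 - |z|)\<close>. The terms
  linear in \<open>t\<close> coming from the second and the third coordinate cancel on the unit
  circle, and up to \<open>O(|t| (1 - |z|))\<close> near it, so only that error and
  \<open>O(|t|^2)\<close> compete with the slack.\<close>

lemma ellipsoid_tangent_disc: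
  fixes a b :: real
  assumes "a > 0" "b > 0" and ab: "2 * a\<^sup>2 + b = 1" and "p \<ge> 1"
  obtains \<delta> where "\<delta> > 0" "\<And>z t. norm z < 1 \<Longrightarrow> norm t < \<delta> * sqrt (1 - norm z) \<Longrightarrow>
    vector [of_real a, of_real a * z ^ p + t, of_real b * z ^ Suc p - 2 * of_real a * z * t] \<in> ellipsoid"
proof -
  \<comment> \<open>\<open>K\<close> collects the coefficients of \<open>|t|^2\<close>, where
    \<open>2 ^ p\<close> bounds \<open>|z| / |z|^p\<close> for \<open>|z| \<ge> 1/2\<close>.
    \<open>M\<close> is the coefficient of \<open>\<delta> (1 - |z|)\<close> in the whole
    perturbation, so \<open>M * \<delta> < b\<close> is what the slack requires; the bound 1/20
    serves the region \<open>|z| < 1/2\<close>.\<close>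
  define K where "K = 1 + 2 * a\<^sup>2 * 2 ^ p / b"
  define M where "M = 2 * a * real p + K"
  have "K > 0"
    using \<open>a > 0\<close> \<open>b > 0\<close> unfolding K_def by (intro add_pos_nonneg) auto
  then have "M > 0"
    using \<open>a > 0\<close> by (simp add: M_def add_nonneg_pos)
  define \<delta> where "\<delta> = min (1/20) (b / (2 * M))"
  have \<delta>: "\<delta> > 0" "\<delta> \<le> 1/20" "M * \<delta> < b"
  proof -
    have "M * \<delta> \<le> M * (b / (2 * M))"
      using \<open>M > 0\<close> by (intro mult_left_mono) (auto simp: \<delta>_def)
    then show "M * \<delta> < b"
      using \<open>M > 0\<close> \<open>b > 0\<close> by simp
  qed (use \<open>M > 0\<close> \<open>b > 0\<close> in \<open>auto simp: \<delta>_def\<close>)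
  have a1: "a < 1"
    using ab \<open>a > 0\<close> \<open>b > 0\<close> by (intro power2_less_imp_less[of a 1]) auto
  have "(norm (complex_of_real a))\<^sup>2 + (norm (of_real a * z ^ p + t))\<^sup>2
      + norm (of_real b * z ^ Suc p - 2 * of_real a * z * t) < 1"
    if z: "norm z < 1" and t: "norm t < \<delta> * sqrt (1 - norm z)" for z t :: complex
  proof -
    define x where "x = norm z"
    define y where "y = norm (z ^ p)"
    define \<tau> where "\<tau> = norm t"
    have x: "0 \<le> x" "x < 1" and y: "0 \<le> y" "y \<le> x" "y = x ^ p" and "\<tau> \<ge> 0"
      using z \<open>p \<ge> 1\<close> power_decreasing[of 1 p x]
      by (auto simp: x_def y_def \<tau>_def norm_power)
    have t1: "\<tau> < \<delta> * sqrt (1 - x)"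
      using t by (simp add: x_def \<tau>_def)
    also have "\<dots> \<le> \<delta> * 1"
      using \<delta> x by (intro mult_left_mono) auto
    finally have t2: "\<tau> < \<delta>" by simp
    have t3: "\<tau>\<^sup>2 \<le> \<delta>\<^sup>2 * (1 - x)"
      using power_mono[OF less_imp_le[OF t1] \<open>\<tau> \<ge> 0\<close>, of 2] x by (simp add: power_mult_distrib)
    have last: "norm (of_real b * z ^ Suc p - 2 * of_real a * z * t)
        = x * norm (of_real b * z ^ p - 2 * of_real a * t)"
      by (simp add: x_def algebra_simps flip: norm_mult)
    show ?thesis
    proof (cases "x < 1/2")
      \<comment> \<open>Far from the boundary the triangle inequality suffices: the sum is at most
        \<open>5 a^2 / 4 + b / 2 + 3 \<tau>\<close>, hence at most \<open>5/8 + 3 \<tau>\<close>,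
        and \<open>\<tau> < 1/20\<close>.\<close>
      case True
      have "norm (of_real a * z ^ p + t) \<le> a * y + \<tau>"
        using norm_triangle_ineq[of "of_real a * z ^ p" t] \<open>a > 0\<close> by (simp add: norm_mult y_def \<tau>_def)
      also have "\<dots> \<le> a / 2 + \<tau>"
        using True y \<open>a > 0\<close> by simp
      finally have "(norm (of_real a * z ^ p + t))\<^sup>2 \<le> (a / 2 + \<tau>)\<^sup>2"
        by (intro power_mono) auto
      also have "\<dots> = a\<^sup>2 / 4 + \<tau> * a + \<tau> * \<tau>"
        by (simp add: power2_eq_square algebra_simps)
      also have "\<dots> \<le> a\<^sup>2 / 4 + \<tau> * 1 + \<tau> * 1"
        using \<open>\<tau> \<ge> 0\<close> a1 t2 \<delta> by (intro add_mono mult_left_mono) auto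
      finally have 2: "(norm (of_real a * z ^ p + t))\<^sup>2 \<le> a\<^sup>2 / 4 + 2 * \<tau>" by simp
      have "norm (of_real b * z ^ p - 2 * of_real a * t) \<le> b * y + 2 * a * \<tau>"
        using norm_triangle_ineq4[of "of_real b * z ^ p" "2 * of_real a * t"] \<open>a > 0\<close> \<open>b > 0\<close>
        by (simp add: norm_mult y_def \<tau>_def)
      also have "\<dots> \<le> b * 1 + 2 * 1 * \<tau>"
        using x y a1 \<open>a > 0\<close> \<open>b > 0\<close> \<open>\<tau> \<ge> 0\<close> by (intro add_mono mult_mono) auto
      finally have "x * norm (of_real b * z ^ p - 2 * of_real a * t) \<le> 1/2 * (b + 2 * \<tau>)"
        using True x \<open>b > 0\<close> \<open>\<tau> \<ge> 0\<close> by (intro mult_mono) auto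
      then show ?thesis
        unfolding last using 2 t2 \<delta> ab \<open>a > 0\<close> \<open>b > 0\<close> by (simp add: power2_abs)
    next
      case False
      then have "y > 0"
        using y x by simp
      define W where "W = z ^ p"
      \<comment> \<open>This real part carries the whole first-order change of both squared moduli
        below.\<close>
      define \<sigma> where "\<sigma> = Re (t * cnj W)"
      have \<sigma>: "\<bar>\<sigma>\<bar> \<le> \<tau> * y"
        using abs_Re_le_cmod[of "t * cnj W"] by (simp only: \<sigma>_def \<tau>_def y_def W_def norm_mult complex_mod_cnj)
      have 2: "(norm (of_real a * z ^ p + t))\<^sup>2 = a\<^sup>2 * y\<^sup>2 + 2 * a * \<sigma> + \<tau>\<^sup>2"
        unfolding y_def \<tau>_def \<sigma>_def W_def[symmetric] cmod_power2 by (simp add: algebra_simps power2_eq_square)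
      define N where "N = norm (of_real b * z ^ p - 2 * of_real a * t)"
      have "N\<^sup>2 = b\<^sup>2 * y\<^sup>2 - 4 * a * b * \<sigma> + 4 * a\<^sup>2 * \<tau>\<^sup>2"
        unfolding N_def y_def \<tau>_def \<sigma>_def W_def[symmetric] cmod_power2 by (simp add: algebra_simps power2_eq_square)
      \<comment> \<open>The arithmetic-geometric mean inequality linearizes the square root:
        \<open>N\<close> gets the first-order term \<open>- 2 a \<sigma> / y\<close>, comparable
        with \<open>2 a \<sigma>\<close> from the second coordinate.\<close>
      moreover have "2 * (b * y) * N \<le> N\<^sup>2 + (b * y)\<^sup>2"
        using sum_squares_bound[of N "b * y"] by (simp add: mult_ac)
      ultimately have "N \<le> (2 * (b * y)\<^sup>2 - 4 * a * b * \<sigma> + 4 * a\<^sup>2 * \<tau>\<^sup>2) / (2 * (b * y))"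
        using \<open>b > 0\<close> \<open>y > 0\<close> by (simp add: field_simps)
      also have "\<dots> = b * y - 2 * a * \<sigma> / y + 2 * a\<^sup>2 * \<tau>\<^sup>2 / (b * y)"
        using \<open>b > 0\<close> \<open>y > 0\<close> by (simp add: field_simps power2_eq_square)
      finally have "x * N \<le> x * (b * y - 2 * a * \<sigma> / y + 2 * a\<^sup>2 * \<tau>\<^sup>2 / (b * y))"
        using x by (intro mult_left_mono)
      also have "\<dots> = b * x * y - 2 * a * \<sigma> * (x / y) + 2 * a\<^sup>2 / b * (x / y) * \<tau>\<^sup>2"
        using \<open>b > 0\<close> \<open>y > 0\<close> by (simp add: field_simps)
      finally have "x * N \<le> b * x * y - 2 * a * \<sigma> * (x / y) + 2 * a\<^sup>2 / b * (x / y) * \<tau>\<^sup>2" .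
      moreover have "2 * a\<^sup>2 / b * (x / y) * \<tau>\<^sup>2 \<le> 2 * a\<^sup>2 / b * 2 ^ p * \<tau>\<^sup>2"
      proof (intro mult_right_mono mult_left_mono)
        have "1 \<le> (2 * x) ^ p"
          using False by (intro one_le_power) simp
        then show "x / y \<le> 2 ^ p"
          using x \<open>y > 0\<close> y(3) by (simp add: power_mult_distrib field_simps)
      qed (use \<open>b > 0\<close> in auto)
      \<comment> \<open>The linear terms cancel up to the factor \<open>1 - x / y\<close>. Since
        \<open>|\<sigma>| \<le> \<tau> y\<close>, the remainder is controlled by
        \<open>\<tau> (x - y)\<close>, and Bernoulli's inequality for \<open>y = x ^ p\<close>
        bounds \<open>x - y\<close> by \<open>p (1 - x)\<close>.\<close>
      moreover have "2 * a * \<sigma> - 2 * a * \<sigma> * (x / y) \<le> 2 * a * (\<tau> * (real p * (1 - x)))"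
      proof -
        have "1 + real p * (x - 1) \<le> (1 + (x - 1)) ^ p"
          using x by (intro Bernoulli_inequality) auto
        then have "x - y \<le> real p * (1 - x)"
          using x y(3) by (simp add: algebra_simps)
        have "\<sigma> * (1 - x / y) \<le> \<bar>\<sigma>\<bar> * \<bar>1 - x / y\<bar>"
          by (metis abs_ge_self abs_mult)
        also have "\<dots> \<le> \<tau> * y * \<bar>1 - x / y\<bar>"
          using \<sigma> by (intro mult_right_mono) auto
        also have "\<dots> = \<tau> * (x - y)"
          using \<open>y > 0\<close> y(2) by (simp add: abs_if field_simps)
        also have "\<dots> \<le> \<tau> * (real p * (1 - x))"
          using \<open>x - y \<le> real p * (1 - x)\<close> \<open>\<tau> \<ge> 0\<close> by (intro mult_left_mono)
        finally have "2 * a * (\<sigma> * (1 - x / y)) \<le> 2 * a * (\<tau> * (real p * (1 - x)))"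
          using \<open>a > 0\<close> by (intro mult_left_mono) auto
        then show ?thesis by (simp add: algebra_simps)
      qed
      moreover have "a\<^sup>2 * y\<^sup>2 \<le> a\<^sup>2 * 1"
        using y x by (intro mult_left_mono) (auto simp: power_le_one)
      moreover have "b * x * y \<le> b * x * 1"
        using y x \<open>b > 0\<close> by (intro mult_left_mono) auto
      \<comment> \<open>The total perturbation is beaten by the slack
        \<open>b (1 - x)\<close>.\<close>
      moreover have "2 * a * (\<tau> * (real p * (1 - x))) + K * \<tau>\<^sup>2 < b * (1 - x)"
      proof -
        have "2 * a * (\<tau> * (real p * (1 - x))) \<le> 2 * a * (\<delta> * (real p * (1 - x)))"
          using t2 x \<open>a > 0\<close> by (intro mult_left_mono mult_right_mono) auto
        moreover have "K * \<tau>\<^sup>2 \<le> K * (\<delta> * (1 - x))"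
        proof (intro mult_left_mono order_trans[OF t3] mult_right_mono)
          show "\<delta>\<^sup>2 \<le> \<delta>"
            using \<delta> by (simp add: power2_eq_square mult_left_le_one_le)
        qed (use \<open>K > 0\<close> x in auto)
        moreover have "M * \<delta> * (1 - x) < b * (1 - x)"
          using \<delta> x by simp
        ultimately show ?thesis
          by (simp add: M_def algebra_simps)
      qed
      moreover have "K * \<tau>\<^sup>2 = \<tau>\<^sup>2 + 2 * a\<^sup>2 / b * 2 ^ p * \<tau>\<^sup>2"
        by (simp add: K_def algebra_simps)
      ultimately show ?thesis
        unfolding last N_def[symmetric] 2 using ab by (simp add: algebra_simps)
    qed
  qed
  then show ?thesis
    using that[of \<delta>] \<delta> by (simp add: ellipsoid_def)
qed

section \<open>Vanishing of tangential derivatives and the obstruction to a left inverse\<close>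

text \<open>With \<open>t\<close> fixed, the increment of \<open>F\<close> along
  \<open>t *s v\<close> is estimated on a circle so near the boundary that \<open>t\<close> is half
  the admissible radius there. It is \<open>O(|t|^2)\<close> on that circle and, by the maximum
  principle, at \<open>z\<close> inside; a quadratic increment has zero derivative.\<close>

lemma tangential_derivative_eq_0:
  fixes F :: "complex ^ 'n \<Rightarrow> complex" and \<phi> v :: "complex \<Rightarrow> complex ^ 'n"
  assumes hol: "holomorphic_several_on F D" and F: "F ` D \<subseteq> unit_disc"
    and F': "(F has_derivative F') (at (\<phi> z))" and lin: "Vector_Spaces.linear (*s) (*) F'"
    and hol\<phi>: "\<And>i. (\<lambda>z. \<phi> z $ i) holomorphic_on unit_disc"
    and holv: "\<And>i. (\<lambda>z. v z $ i) holomorphic_on unit_disc"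
    and "C \<ge> 0" and C: "\<And>z. z \<in> unit_disc \<Longrightarrow> 1 - (norm (F (\<phi> z)))\<^sup>2 \<le> C * (1 - norm z)"
    and "\<delta> > 0" and \<delta>: "\<And>z t. norm z < 1 \<Longrightarrow> norm t < \<delta> * sqrt (1 - norm z) \<Longrightarrow> \<phi> z + t *s v z \<in> D"
    and z: "z \<in> unit_disc"
  shows "F' (v z) = 0"
proof -
  \<comment> \<open>Half the admissible radius at \<open>z\<close>: \<open>norm t < \<eta>\<close>
    puts \<open>z\<close> strictly inside the circle of radius \<open>r\<close> chosen
    below.\<close>
  define \<eta> where "\<eta> = \<delta> * sqrt (1 - norm z) / 2"
  have "\<eta> > 0"
    using z \<open>\<delta> > 0\<close> by (simp add: \<eta>_def)
  have \<eta>2: "4 * \<eta>\<^sup>2 = \<delta>\<^sup>2 * (1 - norm z)"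
    using z by (simp add: \<eta>_def power_mult_distrib power_divide)
  show ?thesis
  proof (rule has_field_derivative_0_if_quadratic_bound[OF _ \<open>\<eta> > 0\<close>])
    show "((\<lambda>t. F (\<phi> z + t *s v z)) has_field_derivative F' (v z)) (at 0)"
    proof (rule has_field_derivative_compose_curve[OF _ lin])
      show "(F has_derivative F') (at (\<phi> z + 0 *s v z))"
        using F' by simp
      show "((\<lambda>t. (\<phi> z + t *s v z) $ i) has_field_derivative v z $ i) (at 0)" for i
        unfolding vector_add_component vector_smult_component
        by (auto intro!: derivative_eq_intros)
    qed
    fix t :: complex assume "t \<noteq> 0" and t: "norm t < \<eta>"
    \<comment> \<open>The admissible radius \<open>\<delta> * sqrt (1 - norm w)\<close> equals
      \<open>2 * norm t\<close> at \<open>norm w = r\<close> and \<open>norm t\<close> at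
      \<open>norm w = r'\<close>. The first leaves room for Schwarz-Pick; \<open>r < r'\<close>
      makes \<open>K\<close> holomorphic beyond the closed disc of radius \<open>r\<close>.\<close>
    define r where "r = 1 - 4 * (norm t)\<^sup>2 / \<delta>\<^sup>2"
    define r' where "r' = 1 - (norm t)\<^sup>2 / \<delta>\<^sup>2"
    have "r < r'" "r' < 1"
      using \<open>t \<noteq> 0\<close> \<open>\<delta> > 0\<close> by (auto simp: r_def r'_def divide_strict_right_mono)
    have "4 * (norm t)\<^sup>2 < \<delta>\<^sup>2 * (1 - norm z)"
      using power_strict_mono[OF t, of 2] \<eta>2 by simp
    then have zr: "norm z < r"
      using \<open>\<delta> > 0\<close> by (simp add: r_def field_simps)
    have tr: "\<delta> * sqrt (1 - r) = 2 * norm t"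
      using \<open>\<delta> > 0\<close> by (simp add: r_def real_sqrt_divide real_sqrt_mult)
    have "\<delta> * sqrt (1 - r') = norm t"
      using \<open>\<delta> > 0\<close> by (simp add: r'_def real_sqrt_divide)
    then have tr': "norm t < \<delta> * sqrt (1 - norm w)" if "norm w < r'" for w :: complex
      using that \<open>\<delta> > 0\<close> by (smt (verit) mult_less_cancel_left_pos real_sqrt_less_iff)
    have sub: "(\<lambda>w. \<phi> w + t *s v w) ` ball 0 r' \<subseteq> D"
      using tr' \<delta> \<open>r' < 1\<close> by auto
    have sub0: "\<phi> ` unit_disc \<subseteq> D"
      using \<delta>[where t=0] \<open>\<delta> > 0\<close> by force
    define K where "K = (\<lambda>w. F (\<phi> w + t *s v w) - F (\<phi> w))"
    have r'1: "ball 0 r' \<subseteq> unit_disc"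
      using \<open>r' < 1\<close> by auto
    have "(\<lambda>w. F (\<phi> w + t *s v w)) holomorphic_on ball 0 r'"
      by (rule holomorphic_on_compose_curve[OF hol _ _ sub])
         (auto intro!: holomorphic_intros holomorphic_on_subset[OF hol\<phi> r'1] holomorphic_on_subset[OF holv r'1])
    moreover have "(\<lambda>w. F (\<phi> w)) holomorphic_on ball 0 r'"
      by (rule holomorphic_on_compose_curve[OF hol _ holomorphic_on_subset[OF hol\<phi> r'1]])
         (use r'1 sub0 in auto)
    ultimately have K: "K holomorphic_on ball 0 r'"
      unfolding K_def by (rule holomorphic_on_diff)
    have "norm (K z) \<le> C * (1 - r)"
    proof (rule maximum_modulus_frontier[of K "cball 0 r"])
      show "K holomorphic_on interior (cball 0 r)" "continuous_on (closure (cball 0 r)) K"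
        using \<open>r < r'\<close> by (auto intro!: holomorphic_on_imp_continuous_on holomorphic_on_subset[OF K])
      show "z \<in> cball 0 r"
        using zr by simp
      fix w :: complex assume "w \<in> frontier (cball 0 r)"
      then have w: "norm w = r"
        using zr by (simp add: dist_norm)
      define k where "k = (\<lambda>s. F (\<phi> w + s *s v w))"
      have subk: "(\<lambda>s. \<phi> w + s *s v w) ` ball 0 (2 * norm t) \<subseteq> D"
        using \<delta>[of w] w \<open>r < r'\<close> \<open>r' < 1\<close> tr by auto
      have "k holomorphic_on ball 0 (2 * norm t)"
        unfolding k_def by (rule holomorphic_on_compose_curve[OF hol _ _ subk]) (auto intro!: holomorphic_intros)
      moreover have "k ` ball 0 (2 * norm t) \<subseteq> unit_disc"
        unfolding k_def using subk F by blast
      ultimately have "norm (k t - k 0) \<le> 2 * (norm t / (2 * norm t)) * (1 - (norm (k 0))\<^sup>2)"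
        using \<open>t \<noteq> 0\<close> by (intro Schwarz_Pick_increment) auto
      also have "\<dots> \<le> C * (1 - r)"
        using C[of w] w \<open>r < r'\<close> \<open>r' < 1\<close> \<open>t \<noteq> 0\<close> by (simp add: k_def)
      finally show "norm (K w) \<le> C * (1 - r)"
        by (simp add: K_def k_def)
    qed simp
    also have "C * (1 - r) = 4 * C / \<delta>\<^sup>2 * (norm t)\<^sup>2"
      by (simp add: r_def)
    finally show "norm (F (\<phi> z + t *s v z) - F (\<phi> z + 0 *s v z)) \<le> 4 * C / \<delta>\<^sup>2 * (norm t)\<^sup>2"
      by (simp add: K_def)
  qed
qed

lemma no_left_inverse_Blaschke:
  fixes a b :: real and F :: "complex ^ 3 \<Rightarrow> complex"
  assumes "a > 0" "b > 0" and ab: "2 * a\<^sup>2 + b = 1" and "p \<ge> 2" and "k \<le> Suc p"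
    and hol: "holomorphic_several_on F ellipsoid" and F: "F ` ellipsoid \<subseteq> unit_disc"
  defines "\<phi> \<equiv> \<lambda>z. vector [of_real a, of_real a * z ^ p, of_real b * z ^ Suc p]"
  assumes Bl: "finite_Blaschke_product k (F \<circ> \<phi>)"
  shows "(F \<circ> \<phi>) constant_on unit_disc"
proof -
  define v :: "complex \<Rightarrow> complex ^ 3" where "v = (\<lambda>z. vector [0, 1, - 2 * of_real a * z])"
  define e2 e3 :: "complex ^ 3" where "e2 = vector [0, 1, 0]" and "e3 = vector [0, 0, 1]"
  obtain DF where DF: "\<And>x. x \<in> ellipsoid \<Longrightarrow> (F has_derivative DF x) (at x)"
    and lin: "\<And>x. x \<in> ellipsoid \<Longrightarrow> Vector_Spaces.linear (*s) (*) (DF x)"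
    using hol unfolding holomorphic_several_on_def by metis
  obtain C where "C > 0" and C: "\<And>z. z \<in> unit_disc \<Longrightarrow> 1 - (norm ((F \<circ> \<phi>) z))\<^sup>2 \<le> C * (1 - norm z)"
    using finite_Blaschke_product_boundary_bound[OF Bl] by blast
  have "1 \<le> p"
    using \<open>p \<ge> 2\<close> by simp
  obtain \<delta> where "\<delta> > 0" and \<delta>: "\<And>z t. norm z < 1 \<Longrightarrow> norm t < \<delta> * sqrt (1 - norm z) \<Longrightarrow>
      vector [of_real a, of_real a * z ^ p + t, of_real b * z ^ Suc p - 2 * of_real a * z * t] \<in> ellipsoid"
    by (rule ellipsoid_tangent_disc[OF \<open>a > 0\<close> \<open>b > 0\<close> ab \<open>1 \<le> p\<close>]) (rule that)
  have tube: "\<phi> z + t *s v z \<in> ellipsoid" if "norm z < 1" "norm t < \<delta> * sqrt (1 - norm z)" for z t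
  proof -
    have "\<phi> z + t *s v z
        = vector [of_real a, of_real a * z ^ p + t, of_real b * z ^ Suc p - 2 * of_real a * z * t]"
      by (simp add: \<phi>_def v_def vec_eq_iff forall_3 algebra_simps)
    then show ?thesis
      using \<delta>[OF that] by simp
  qed
  have \<phi>: "\<phi> z \<in> ellipsoid" if "norm z < 1" for z
    using tube[of z 0] that \<open>\<delta> > 0\<close> by simp
  have tang: "DF (\<phi> z) (v z) = 0" if z: "z \<in> unit_disc" for z
  proof (rule tangential_derivative_eq_0[OF hol F DF lin, where C = C and \<delta> = \<delta>])
    show "(\<lambda>z. \<phi> z $ i) holomorphic_on unit_disc" "(\<lambda>z. v z $ i) holomorphic_on unit_disc" for i
      using exhaust_3[of i] by (auto simp: \<phi>_def v_def intro!: holomorphic_intros)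
  qed (use C \<open>C > 0\<close> \<open>\<delta> > 0\<close> tube \<phi> z in auto)
  \<comment> \<open>Determined by \<open>2 a \<phi>'(z) = c z^q e2 - b (p + 1) z^q v(z)\<close>,
    whose last term is annihilated by the derivative of \<open>F\<close>.\<close>
  define c where "c = 2 * a\<^sup>2 * real p + b * real (Suc p)"
  define q where "q = p - 1"
  have p: "p = Suc q"
    using \<open>p \<ge> 2\<close> by (simp add: q_def)
  define \<phi>' :: "complex \<Rightarrow> complex ^ 3" where
    "\<phi>' = (\<lambda>z. vector [0, of_real a * (of_nat p * z ^ q), of_real b * (of_nat (Suc p) * z ^ p)])"
  have deriv: "((F \<circ> \<phi>) has_field_derivative DF (\<phi> z) (\<phi>' z)) (at z)" if "norm z < 1" for z
    unfolding o_def
  proof (rule has_field_derivative_compose_curve[where g = \<phi>, OF DF[OF \<phi>[OF that]] lin[OF \<phi>[OF that]]])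
    show "((\<lambda>z. \<phi> z $ i) has_field_derivative \<phi>' z $ i) (at z)" for i
      using exhaust_3[of i]
      by (auto simp: \<phi>_def \<phi>'_def p simp del: power_Suc intro!: derivative_eq_intros)
  qed
  have B': "2 * of_real a * DF (\<phi> z) (\<phi>' z) = of_real c * z ^ q * DF (\<phi> z) e2" if "norm z < 1" for z
  proof -
    interpret DF: Vector_Spaces.linear "(*s)" "(*)" "DF (\<phi> z)"
      by (rule lin[OF \<phi>[OF that]])
    have "(2 * of_real a) *s \<phi>' z = (of_real c * z ^ q) *s e2 - (of_real b * of_nat (Suc p) * z ^ q) *s v z"
      by (simp add: \<phi>'_def e2_def v_def c_def p vec_eq_iff forall_3 algebra_simps power2_eq_square)
    then have "DF (\<phi> z) ((2 * of_real a) *s \<phi>' z)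
        = DF (\<phi> z) ((of_real c * z ^ q) *s e2 - (of_real b * of_nat (Suc p) * z ^ q) *s v z)"
      by simp
    then show ?thesis
      using tang that by (simp add: DF.diff DF.scale)
  qed
  have "v 0 = e2"
    by (simp add: v_def e2_def)
  then have e2: "DF (\<phi> 0) e2 = 0"
    using tang[of 0] by simp
  obtain L \<epsilon> where "\<epsilon> > 0" "L \<ge> 0"
    and L: "\<And>x. x \<in> ball (\<phi> 0) \<epsilon> \<Longrightarrow> norm (DF x e2 - DF (\<phi> 0) e2) \<le> L * norm (x - \<phi> 0)"
  proof (rule holomorphic_several_on_derivative_Lipschitz[OF hol F DF lin open_ellipsoid, where w = e2])
    show "\<phi> 0 \<in> ellipsoid"
      using \<phi>[of 0] by simp
  qed (assumption | rule that)+
  define A where "A = a * norm e2 + b * norm e3"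
  have "A \<ge> 0"
    using \<open>a > 0\<close> \<open>b > 0\<close> by (simp add: A_def)
  have \<phi>0: "norm (\<phi> z - \<phi> 0) \<le> A * norm z ^ p" if z: "norm z < 1" for z
  proof -
    have "\<phi> z - \<phi> 0 = (of_real a * z ^ p) *s e2 + (of_real b * z ^ Suc p) *s e3"
      by (simp add: \<phi>_def e2_def e3_def vec_eq_iff forall_3 p)
    also have "norm \<dots> \<le> a * norm z ^ p * norm e2 + b * norm z ^ Suc p * norm e3"
      using \<open>a > 0\<close> \<open>b > 0\<close>
      by (intro order_trans[OF norm_triangle_ineq]) (simp add: norm_vector_scalar_mult norm_mult norm_power)
    also have "\<dots> \<le> a * norm z ^ p * norm e2 + b * norm z ^ p * norm e3"
      using z \<open>b > 0\<close> by (intro add_mono mult_right_mono mult_left_mono power_decreasing) auto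
    finally show ?thesis
      by (simp add: A_def algebra_simps)
  qed
  define M where "M = \<bar>c\<bar> * L * A / (2 * a)"
  \<comment> \<open>Keeps \<open>\<phi> z\<close> in the ball of the Lipschitz bound, since
    \<open>A * norm z ^ p \<le> A * norm z < \<epsilon>\<close>; the \<open>+ 1\<close> makes the
    denominator positive from \<open>A \<ge> 0\<close> alone.\<close>
  define \<epsilon>' where "\<epsilon>' = min 1 (\<epsilon> / (A + 1))"
  have "\<epsilon>' > 0"
    using \<open>\<epsilon> > 0\<close> \<open>A \<ge> 0\<close> by (simp add: \<epsilon>'_def)
  have bound: "norm (DF (\<phi> z) (\<phi>' z)) \<le> M * norm z ^ Suc p" if z: "norm z < \<epsilon>'" for z
  proof -
    have z1: "norm z < 1" and "norm z < \<epsilon> / (A + 1)"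
      using z by (auto simp: \<epsilon>'_def)
    then have "(A + 1) * norm z < \<epsilon>"
      using \<open>A \<ge> 0\<close> by (simp add: field_simps)
    have "norm z ^ p \<le> norm z"
      using power_decreasing[of 1 p "norm z"] z1 \<open>p \<ge> 2\<close> by simp
    then have "A * norm z ^ p \<le> A * norm z"
      using \<open>A \<ge> 0\<close> by (intro mult_left_mono)
    also have "\<dots> < \<epsilon>"
      using \<open>(A + 1) * norm z < \<epsilon>\<close> norm_ge_zero[of z] by (simp add: distrib_right del: norm_ge_zero)
    finally have "\<phi> z \<in> ball (\<phi> 0) \<epsilon>"
      using \<phi>0[OF z1] by (simp add: dist_norm norm_minus_commute)
    from L[OF this] have "norm (DF (\<phi> z) e2) \<le> L * norm (\<phi> z - \<phi> 0)"
      by (simp add: e2)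
    also have "\<dots> \<le> L * (A * norm z ^ p)"
      using \<phi>0[OF z1] \<open>L \<ge> 0\<close> by (intro mult_left_mono)
    finally have le: "norm (DF (\<phi> z) e2) \<le> L * A * norm z ^ p"
      by simp
    have "2 * a * norm (DF (\<phi> z) (\<phi>' z)) = norm (2 * of_real a * DF (\<phi> z) (\<phi>' z))"
      using \<open>a > 0\<close> by (simp add: norm_mult)
    also have "\<dots> = \<bar>c\<bar> * norm z ^ q * norm (DF (\<phi> z) e2)"
      by (simp add: B'[OF z1] norm_mult norm_power)
    also have "\<dots> \<le> \<bar>c\<bar> * norm z ^ q * (L * A * norm z ^ p)"
      using le by (intro mult_left_mono) auto
    also have "\<dots> = \<bar>c\<bar> * L * A * norm z ^ (q + p)"
      by (simp add: power_add)
    \<comment> \<open>The exponent is \<open>q + p = 2 p - 1\<close>, and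
      \<open>2 p - 1 \<ge> p + 1\<close> is precisely \<open>p \<ge> 2\<close>, that is
      \<open>m \<ge> 5\<close> for \<open>p = m - 3\<close>.\<close>
    also have "\<dots> \<le> \<bar>c\<bar> * L * A * norm z ^ Suc p"
      using z1 \<open>p \<ge> 2\<close> \<open>L \<ge> 0\<close> \<open>A \<ge> 0\<close> by (intro mult_left_mono power_decreasing) (auto simp: q_def)
    finally show ?thesis
      using \<open>a > 0\<close> by (simp add: M_def field_simps)
  qed
  have "M \<ge> 0"
    using \<open>L \<ge> 0\<close> \<open>A \<ge> 0\<close> \<open>a > 0\<close> by (simp add: M_def)
  show ?thesis
  proof (rule finite_Blaschke_product_constant[OF Bl \<open>\<epsilon>' > 0\<close>])
    fix z :: complex assume z: "norm z < \<epsilon>'"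
    then have "norm z < 1"
      by (simp add: \<epsilon>'_def)
    \<comment> \<open>The mean value inequality adds one power: order \<open>p + 2\<close>, which is
      at least \<open>k + 1\<close> because \<open>k \<le> p + 1\<close>.\<close>
    have "norm ((F \<circ> \<phi>) z - (F \<circ> \<phi>) 0) \<le> M * norm z ^ Suc p * norm (z - 0)"
    proof (rule field_differentiable_bound[OF convex_cball])
      fix w :: complex assume "w \<in> cball 0 (norm z)"
      then have w: "norm w \<le> norm z" by simp
      show "((F \<circ> \<phi>) has_field_derivative DF (\<phi> w) (\<phi>' w)) (at w within cball 0 (norm z))"
        by (rule has_field_derivative_at_within[OF deriv]) (use w \<open>norm z < 1\<close> in linarith)
      have "norm (DF (\<phi> w) (\<phi>' w)) \<le> M * norm w ^ Suc p"
        by (rule bound) (use w z in linarith)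
      also have "\<dots> \<le> M * norm z ^ Suc p"
        using w \<open>M \<ge> 0\<close> by (intro mult_left_mono power_mono) auto
      finally show "norm (DF (\<phi> w) (\<phi>' w)) \<le> M * norm z ^ Suc p" .
    qed auto
    also have "\<dots> = M * norm z ^ Suc (Suc p)"
      by simp
    also have "\<dots> \<le> M * norm z ^ Suc k"
      using \<open>norm z < 1\<close> \<open>M \<ge> 0\<close> \<open>k \<le> Suc p\<close> by (intro mult_left_mono power_decreasing) auto
    finally show "norm ((F \<circ> \<phi>) z - (F \<circ> \<phi>) 0) \<le> M * norm z ^ Suc k" .
  qed
qed

section \<open>The explicit left inverse of \<open>f\<close> and the comparison of the two
  maps\<close>

lemma remove_sings_power_divide:
  "remove_sings (\<lambda>w. c * w ^ Suc n / w) z = c * z ^ n"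
proof (rule remove_sings_eqI)
  have "((\<lambda>w. c * w ^ n) \<longlongrightarrow> c * z ^ n) (at z)"
    by (intro tendsto_intros)
  moreover have "\<forall>\<^sub>F w in at z. c * w ^ n = c * w ^ Suc n / w"
    using eventually_neq_at_within[of 0 z UNIV] by eventually_elim simp
  ultimately show "((\<lambda>w. c * w ^ Suc n / w) \<longlongrightarrow> c * z ^ n) (at z)"
    by (rule Lim_transform_eventually)
qed

text \<open>\<open>2 |z1 z2| \<le> |z1|^2 + |z2|^2\<close> shows that \<open>F\<close> maps the
  ellipsoid into the disc. Along the curve \<open>z1 z2\<close> is \<open>a^2 z^(m-1)\<close>, so
  the composite is \<open>(2 a^2 + b) z^(m-1) = z^(m-1)\<close>, a Blaschke product with all zeros
  at 0.\<close>

lemma geodesic_ellipsoid_monomial: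
  fixes a b :: real
  assumes "a > 0" "b > 0" and ab: "2 * a\<^sup>2 + b = 1" and "m \<ge> 3"
  shows "geodesic m (\<lambda>z. vector [of_real a * z, of_real a * z ^ (m - 2), of_real b * z ^ (m - 1)]) ellipsoid"
proof -
  define f :: "complex \<Rightarrow> complex ^ 3" where
    "f = (\<lambda>z. vector [of_real a * z, of_real a * z ^ (m - 2), of_real b * z ^ (m - 1)])"
  define F :: "complex ^ 3 \<Rightarrow> complex" where "F = (\<lambda>z. 2 * (z $ 1 * z $ 2) + z $ 3)"
  have "f z \<in> ellipsoid" if "norm z < 1" for z
  proof -
    have pow: "norm z ^ n \<le> norm z" if "n \<ge> 1" for n
      using power_decreasing[of 1 n "norm z"] that \<open>norm z < 1\<close> by simp
    have "(a * norm z)\<^sup>2 + (a * norm z ^ (m - 2))\<^sup>2 + b * norm z ^ (m - 1)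
        \<le> a\<^sup>2 * norm z + a\<^sup>2 * norm z + b * norm z"
      unfolding power_mult_distrib power_mult[symmetric] using \<open>m \<ge> 3\<close> \<open>b > 0\<close>
      by (intro add_mono mult_left_mono pow) auto
    also have "\<dots> = (2 * a\<^sup>2 + b) * norm z"
      by (simp add: algebra_simps)
    finally show ?thesis
      using \<open>a > 0\<close> \<open>b > 0\<close> that unfolding ab by (simp add: ellipsoid_def f_def norm_mult norm_power)
  qed
  moreover have "(\<lambda>z. f z $ i) holomorphic_on unit_disc" for i
    using exhaust_3[of i] by (auto simp: f_def intro!: holomorphic_intros)
  ultimately have "holomorphic_disc_map f ellipsoid"
    by (auto simp: holomorphic_disc_map_def)
  moreover have "holomorphic_several_on F ellipsoid"
    unfolding holomorphic_several_on_def
  proof (intro ballI exI conjI)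
    fix z :: "complex ^ 3"
    show "(F has_derivative (\<lambda>h. 2 * (z $ 1 * h $ 2 + h $ 1 * z $ 2) + h $ 3)) (at z)"
      unfolding F_def
      by (auto intro!: derivative_eq_intros bounded_linear.has_derivative[OF bounded_linear_vec_nth])
    show "Vector_Spaces.linear (*s) (*) (\<lambda>h. 2 * (z $ 1 * h $ 2 + h $ 1 * z $ 2) + h $ 3)"
      by unfold_locales (simp_all add: algebra_simps)
  qed
  moreover have "F ` ellipsoid \<subseteq> unit_disc"
  proof (rule image_subsetI)
    fix z assume "z \<in> ellipsoid"
    have "norm (F z) \<le> 2 * norm (z $ 1) * norm (z $ 2) + norm (z $ 3)"
      unfolding F_def using norm_triangle_ineq[of "2 * (z $ 1 * z $ 2)" "z $ 3"]
      by (simp add: norm_mult)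
    also have "\<dots> \<le> (norm (z $ 1))\<^sup>2 + (norm (z $ 2))\<^sup>2 + norm (z $ 3)"
      using sum_squares_bound[of "norm (z $ 1)" "norm (z $ 2)"] by simp
    finally show "F z \<in> unit_disc"
      using \<open>z \<in> ellipsoid\<close> by (simp add: ellipsoid_def)
  qed
  moreover have Ff: "F \<circ> f = (\<lambda>z. z ^ (m - 1))"
  proof
    fix z :: complex
    have "m - 1 = Suc (m - 2)"
      using \<open>m \<ge> 3\<close> by simp
    then have "(F \<circ> f) z = of_real (2 * a\<^sup>2 + b) * z ^ (m - 1)"
      by (simp add: F_def f_def algebra_simps power2_eq_square)
    then show "(F \<circ> f) z = z ^ (m - 1)"
      by (simp only: ab) simp
  qed
  moreover have "\<not> (F \<circ> f) constant_on unit_disc"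
  proof
    assume "(F \<circ> f) constant_on unit_disc"
    then obtain c where "\<And>z. z \<in> unit_disc \<Longrightarrow> z ^ (m - 1) = c"
      unfolding Ff constant_on_def by blast
    from this[of 0] this[of "1/2"] show False
      using \<open>m \<ge> 3\<close> by (simp add: power_0_left norm_divide)
  qed
  moreover have "finite_Blaschke_product (m - 1) (F \<circ> f)"
    unfolding finite_Blaschke_product_def Ff
    by (intro exI[of _ 1] exI[of _ "\<lambda>_. 0"]) (simp add: Moebius_function_simple)
  ultimately show ?thesis
    unfolding geodesic_def f_def[symmetric] using open_ellipsoid connected_ellipsoid by blast
qed

theorem proposition4p5:
  fixes m :: nat and a b :: real and f \<phi> :: "complex \<Rightarrow> complex ^ 3"
  assumes "m \<ge> 5" and "a > 0" and "b > 0" and "2 * a\<^sup>2 + b = 1"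
  defines "f \<equiv> \<lambda>z. vector [of_real a * z, of_real a * z ^ (m - 2), of_real b * z ^ (m - 1)]"
  defines "\<phi> \<equiv> divide_by_id f"
  shows "geodesic m f ellipsoid \<and>
    holomorphic_disc_map \<phi> ellipsoid \<and> \<not> geodesic (m - 1) \<phi> ellipsoid"
proof -
  define p where "p = m - 3"
  \<comment> \<open>The second subtraction in \<open>m - 1 - 1\<close> comes from the definition of
    \<open>geodesic\<close>: an \<open>(m-1)\<close>-geodesic allows Blaschke degree at most
    \<open>m - 2 = Suc p\<close>.\<close>
  have m: "m - 2 = Suc p" "m - 1 = Suc (Suc p)" "m - 1 - 1 = Suc p" and "p \<ge> 2"
    using \<open>m \<ge> 5\<close> by (auto simp: p_def)
  have \<phi>: "\<phi> = (\<lambda>z. vector [of_real a, of_real a * z ^ p, of_real b * z ^ Suc p])"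
  proof
    fix z
    show "\<phi> z = vector [of_real a, of_real a * z ^ p, of_real b * z ^ Suc p]"
      using remove_sings_power_divide[of "of_real a" 0 z] remove_sings_power_divide[of "of_real a" p z]
        remove_sings_power_divide[of "of_real b" "Suc p" z]
      unfolding \<phi>_def divide_by_id_def f_def m by (simp add: vec_eq_iff forall_3)
  qed
  have "1 \<le> p"
    using \<open>p \<ge> 2\<close> by simp
  obtain \<delta> where "\<delta> > 0" and \<delta>: "\<And>z t. norm z < 1 \<Longrightarrow> norm t < \<delta> * sqrt (1 - norm z) \<Longrightarrow>
      vector [of_real a, of_real a * z ^ p + t, of_real b * z ^ Suc p - 2 * of_real a * z * t] \<in> ellipsoid"
    by (rule ellipsoid_tangent_disc[OF \<open>a > 0\<close> \<open>b > 0\<close> \<open>2 * a\<^sup>2 + b = 1\<close> \<open>1 \<le> p\<close>]) (rule that)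
  \<comment> \<open>The centre \<open>t = 0\<close> of each tangent disc. Being a disc map is part
    of \<open>geodesic\<close>, so establishing it separately shows that the failure lies in the
    left inverse.\<close>
  have "\<phi> z \<in> ellipsoid" if "norm z < 1" for z
    using \<delta>[of z 0] that \<open>\<delta> > 0\<close> by (simp add: \<phi>)
  moreover have "(\<lambda>z. \<phi> z $ i) holomorphic_on unit_disc" for i
    using exhaust_3[of i] by (auto simp: \<phi> intro!: holomorphic_intros)
  ultimately have "holomorphic_disc_map \<phi> ellipsoid"
    by (auto simp: holomorphic_disc_map_def)
  moreover have "\<not> geodesic (m - 1) \<phi> ellipsoid"
  proof
    assume "geodesic (m - 1) \<phi> ellipsoid"
    then obtain F k where F: "holomorphic_several_on F ellipsoid" "F ` ellipsoid \<subseteq> unit_disc"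
      and nc: "\<not> (F \<circ> \<phi>) constant_on unit_disc"
      and k: "k \<le> Suc p" and Bl: "finite_Blaschke_product k (F \<circ> \<phi>)"
      unfolding geodesic_def m(3) by (elim conjE exE) (rule that)
    have "(F \<circ> \<phi>) constant_on unit_disc"
      using no_left_inverse_Blaschke[OF assms(2-4) \<open>p \<ge> 2\<close> k F] Bl unfolding \<phi> .
    with nc show False by contradiction
  qed
  moreover have "geodesic m f ellipsoid"
    unfolding f_def using assms(1-4) by (intro geodesic_ellipsoid_monomial) auto
  ultimately show ?thesis by blast
qed

end
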